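(* Let $\mathbb{F}_q$ be the finite field with $q$ elements, let $n\ge 0$ be an integer, let $\mathcal{F}$ be a vector space over $\mathbb{F}_q$, and let $\phi\colon\mathcal{F}\to\mathrm{Map}(\mathbb{P}^n(\mathbb{F}_q),\mathbb{F}_q)$ be a homomorphism of vector spaces over $\mathbb{F}_q$. Then any nonempty subset of $\mathbb{P}^n(\mathbb{F}_q)$ defined by some members of $\mathcal{F}$ can be defined using at most $n$ members of $\mathcal{F}$. That is, for every subset $\mathcal{G}\subseteq\mathcal{F}$ such that the set $V=\{x\in\mathbb{P}^n(\mathbb{F}_q) : \phi(f)(x)=0\text{ for all } f\in\mathcal{G}\}$ is nonempty, there exist an integer $0\le m\le n$ and $h_1,\ldots,h_m\in\mathcal{F}$ such that $$V=\{x\in\mathbb{P}^n(\mathbb{F}_q) : \phi(h_1)(x)=\cdots=\phi(h_m)(x)=0\}.$$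
   Context: $\mathbb{P}^n(\mathbb{F}_q)$ denotes (the set of points of) the projective $n$-space over $\mathbb{F}_q$. For a set $X$, $\mathrm{Map}(X,\mathbb{F}_q)$ denotes the $\mathbb{F}_q$-vector space of all functions $X\to\mathbb{F}_q$ (with pointwise operations). The subset defined by some members of $\mathcal{F}$ is the common zero locus of their images via $\phi$; when $m=0$ (no members used) the zero locus is all of $\mathbb{P}^n(\mathbb{F}_q)$. *)

theory Defs
  imports "HOL-Analysis.Finite_Cartesian_Product" "HOL-Library.Function_Algebras"
begin

definition proportional :: "'k::field ^ 'd \<Rightarrow> 'k ^ 'd \<Rightarrow> bool"
  where "proportional v w \<longleftrightarrow> v \<noteq> 0 \<and> w \<noteq> 0 \<and> (\<exists>c. c \<noteq> 0 \<and> w = c *s v)"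

(* The partial quotient discards the zero vector, which is not related to itself. The points
   of projective n-space over 'k are the elements of this type when CARD('d) = n + 1. *)
quotient_type (overloaded) ('k, 'd) proj = "'k::field ^ 'd::finite" / partial: proportional
proof (rule part_equivpI)
  have "proportional (1 :: 'k ^ 'd) 1"
    unfolding proportional_def by (auto intro!: exI[of _ 1])
  then show "\<exists>v :: 'k ^ 'd. proportional v v" by blast
  show "symp (proportional :: 'k ^ 'd \<Rightarrow> _)"
  proof (rule sympI)
    fix v w :: "'k ^ 'd"
    assume "proportional v w"
    then obtain c where "v \<noteq> 0" "w \<noteq> 0" "c \<noteq> 0" "w = c *s v"
      unfolding proportional_def by blast
    then show "proportional w v"
      unfolding proportional_def by (auto simp: vec_eq_iff intro!: exI[of _ "inverse c"])
  qed
  show "transp (proportional :: 'k ^ 'd \<Rightarrow> _)"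
  proof (rule transpI)
    fix u v w :: "'k ^ 'd"
    assume "proportional u v" "proportional v w"
    then obtain b c where "u \<noteq> 0" "w \<noteq> 0" "b \<noteq> 0" "v = b *s u" "c \<noteq> 0" "w = c *s v"
      unfolding proportional_def by blast
    then show "proportional u w"
      unfolding proportional_def by (auto simp: vec_eq_iff intro!: exI[of _ "c * b"])
  qed
qed

definition map_scale :: "'k::field \<Rightarrow> ('x \<Rightarrow> 'k) \<Rightarrow> ('x \<Rightarrow> 'k)"
  where "map_scale c f = (\<lambda>x. c * f x)"

lemma vector_space_map_scale: "vector_space map_scale"
  by unfold_locales (auto simp: map_scale_def fun_eq_iff algebra_simps)

end

theory Submission
  imports Defs
begin

text \<open>
  Let \<open>q\<close> be the size of the field and \<open>W\<close> the span of the image of \<open>G\<close>. At a point outside \<open>V\<close>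
  exactly one \<open>q\<close>-th of the members of \<open>W\<close> vanish, so on a nonempty set \<open>U\<close> disjoint from \<open>V\<close>
  an average member of \<open>W\<close> has \<open>card U / q\<close> zeros. As \<open>0\<close> has more, some member has strictly fewer.
  Starting from the complement of \<open>V\<close>, which has at most \<open>q + \<dots> + q^n\<close> points because \<open>V\<close> is
  nonempty, such a choice leaves fewer than \<open>1 + \<dots> + q^(n-1)\<close> points, that is, at most
  \<open>q + \<dots> + q^(n-1)\<close>; after \<open>n\<close> choices no point is left.
\<close>

interpretation fun_space: vector_space map_scale
  by (rule vector_space_map_scale)

lemma two_le_card_field: "2 \<le> CARD('k::{field,finite})"
proof -
  have "card {0, 1 :: 'k} \<le> CARD('k)" by (rule card_mono) auto
  then show ?thesis by simp
qed

text \<open>Evaluation at \<open>x\<close> is a nonzero linear functional on \<open>W\<close>, so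
  \<open>W\<close> is the direct sum of its kernel and the line spanned by \<open>g\<close>;
  \<open>f x / g x\<close> is the coefficient of \<open>f\<close> along \<open>g\<close>.\<close>

lemma card_subspace_vanishing:
  fixes W :: "('x \<Rightarrow> 'k::{field,finite}) set"
  assumes W: "fun_space.subspace W" and g: "g \<in> W" "g x \<noteq> 0"
  shows "CARD('k) * card {f \<in> W. f x = 0} = card W"
proof -
  let ?Z = "{f \<in> W. f x = 0}"
  have "bij_betw (\<lambda>(c, f). f + map_scale c g) (UNIV \<times> ?Z) W"
  proof (rule bij_betwI[where g = "\<lambda>f. (f x / g x, f - map_scale (f x / g x) g)"])
    show "(\<lambda>(c, f). f + map_scale c g) \<in> UNIV \<times> ?Z \<rightarrow> W"
      using g W by (auto intro!: fun_space.subspace_add fun_space.subspace_scale)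
    show "(\<lambda>f. (f x / g x, f - map_scale (f x / g x) g)) \<in> W \<rightarrow> UNIV \<times> ?Z"
    proof
      fix f assume "f \<in> W"
      then have "f - map_scale (f x / g x) g \<in> W"
        using g W by (intro fun_space.subspace_diff fun_space.subspace_scale)
      moreover have "(f - map_scale (f x / g x) g) x = 0"
        using g by (simp add: map_scale_def)
      ultimately show "(f x / g x, f - map_scale (f x / g x) g) \<in> UNIV \<times> ?Z" by simp
    qed
  qed (use g in \<open>auto simp: map_scale_def\<close>)
  then have "card ((UNIV :: 'k set) \<times> ?Z) = card W" by (rule bij_betw_same_card)
  then show ?thesis by (simp add: card_cartesian_product)
qed

lemma exists_few_zeros:
  fixes W :: "('x \<Rightarrow> 'k::{field,finite}) set"
  assumes W: "fun_space.subspace W" and fin: "finite W" and U: "finite U" "U \<noteq> {}"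
    and nz: "\<And>x. x \<in> U \<Longrightarrow> \<exists>g\<in>W. g x \<noteq> 0"
  shows "\<exists>g\<in>W. CARD('k) * card {x \<in> U. g x = 0} < card U"
proof (rule ccontr)
  assume "\<not> ?thesis"
  then have ge: "card U \<le> CARD('k) * card {x \<in> U. g x = 0}" if "g \<in> W" for g
    using that by force
  have 0: "0 \<in> W" using W by (rule fun_space.subspace_0)
  have "card U * 1 < card U * CARD('k)"
    using U two_le_card_field[where 'k = 'k] by (intro mult_strict_left_mono) auto
  \<comment> \<open>The zero function vanishes on all of \<open>U\<close>, which makes the sum
    inequality below strict.\<close>
  then have lt: "card U < CARD('k) * card {x \<in> U. (0 :: 'x \<Rightarrow> 'k) x = 0}"
    by (simp add: mult.commute)
  \<comment> \<open>Double counting of the pairs \<open>(g, x)\<close> with \<open>g x = 0\<close>: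
    first by functions, then by points.\<close>
  have "card W * card U = (\<Sum>g\<in>W. card U)" by simp
  also have "\<dots> < (\<Sum>g\<in>W. CARD('k) * card {x \<in> U. g x = 0})"
    using fin ge lt 0 by (intro sum_strict_mono_ex1) blast+
  also have "\<dots> = CARD('k) * (\<Sum>g\<in>W. \<Sum>x\<in>U. if g x = 0 then 1 else 0)"
    using U by (simp add: sum_distrib_left flip: sum.inter_filter)
  also have "\<dots> = CARD('k) * (\<Sum>x\<in>U. \<Sum>g\<in>W. if g x = 0 then 1 else 0)"
    by (subst sum.swap) simp
  also have "\<dots> = (\<Sum>x\<in>U. CARD('k) * card {g \<in> W. g x = 0})"
    using fin by (simp add: sum_distrib_left flip: sum.inter_filter)
  also have "\<dots> = (\<Sum>x\<in>U. card W)"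
    using card_subspace_vanishing[OF W] nz by (intro sum.cong refl) blast
  finally show False by (simp add: mult.commute)
qed

lemma exists_no_common_zero:
  fixes W :: "('x \<Rightarrow> 'k::{field,finite}) set"
  assumes W: "fun_space.subspace W" and fin: "finite W" and "finite U"
    and "\<And>x. x \<in> U \<Longrightarrow> \<exists>g\<in>W. g x \<noteq> 0"
    and "card U \<le> (\<Sum>i=1..n. CARD('k) ^ i)"
  shows "\<exists>h. (\<forall>i. h i \<in> W) \<and> (\<forall>x\<in>U. \<exists>i\<in>{1..n}. h i x \<noteq> 0)"
  using assms(3-)
proof (induction n arbitrary: U)
  case 0
  \<comment> \<open>The bound is an empty sum, so \<open>U\<close> is empty and the constant family
    \<open>0\<close> serves.\<close>
  then show ?case using fun_space.subspace_0[OF W] by auto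
next
  case (Suc n)
  show ?case
  proof (cases "U = {}")
    case True
    then show ?thesis using fun_space.subspace_0[OF W] by auto
  next
    case False
    then obtain g where g: "g \<in> W" "CARD('k) * card {x \<in> U. g x = 0} < card U"
      using exists_few_zeros[OF W fin Suc.prems(1)] Suc.prems(2) by blast
    let ?U = "{x \<in> U. g x = 0}"
    have "(\<Sum>i=1..Suc n. CARD('k) ^ i) = CARD('k) * (\<Sum>i=0..n. CARD('k) ^ i)"
      unfolding One_nat_def sum.shift_bounds_cl_Suc_ivl by (simp add: sum_distrib_left)
    then have "CARD('k) * card ?U < CARD('k) * (\<Sum>i=0..n. CARD('k) ^ i)"
      using g(2) Suc.prems(3) by linarith
    then have "card ?U < (\<Sum>i=0..n. CARD('k) ^ i)" by simp
    \<comment> \<open>The strict inequality pays for the summand \<open>CARD('k) ^ 0 = 1\<close>, so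
      the bound regains its form, with \<open>n\<close> for \<open>Suc n\<close>.\<close>
    then have "card ?U \<le> (\<Sum>i=1..n. CARD('k) ^ i)"
      by (simp add: sum.atLeast_Suc_atMost)
    then have "\<exists>h. (\<forall>i. h i \<in> W) \<and> (\<forall>x\<in>?U. \<exists>i\<in>{1..n}. h i x \<noteq> 0)"
      by (intro Suc.IH) (use Suc.prems(1,2) in simp_all)
    then obtain h where h: "\<forall>i. h i \<in> W" "\<forall>x\<in>?U. \<exists>i\<in>{1..n}. h i x \<noteq> 0"
      by (elim exE conjE)
    have "\<exists>i\<in>{1..Suc n}. (h(Suc n := g)) i x \<noteq> 0" if "x \<in> U" for x
    proof (cases "g x = 0")
      case True
      then have "\<exists>i\<in>{1..n}. h i x \<noteq> 0" using h(2) that by simp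
      then obtain i where "i \<in> {1..n}" "h i x \<noteq> 0" by (elim bexE)
      then show ?thesis by (intro bexI[of _ i]) auto
    next
      case False
      then show ?thesis by (intro bexI[of _ "Suc n"]) auto
    qed
    then show ?thesis using h(1) g(1) by (intro exI[of _ "h(Suc n := g)"]) auto
  qed
qed

lemma finite_proj: "finite (UNIV :: ('k::{field,finite}, 'd::finite) proj set)"
proof (rule finite_surj)
  show "finite (UNIV :: ('k ^ 'd) set)" by simp
  show "UNIV \<subseteq> range (abs_proj :: 'k ^ 'd \<Rightarrow> _)"
    using Quotient_abs_rep[OF Quotient_proj] by (metis subsetI rangeI)
qed

text \<open>Nonzero multiples of chosen representatives are nonzero vectors, distinct for distinct
  pairs of scalar and point; the bound is then a geometric sum.\<close>

lemma card_proj_le: "CARD(('k::{field,finite}, 'd::finite) proj) \<le> (\<Sum>i<CARD('d). CARD('k) ^ i)"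
proof -
  let ?q = "CARD('k)"
  let ?f = "\<lambda>(c, p). c *s rep_proj (p :: ('k, 'd) proj)"
  have rep: "proportional (rep_proj p) (rep_proj p)" for p :: "('k, 'd) proj"
    by (rule Quotient_rep_reflp[OF Quotient_proj])
  then have rep_nz: "rep_proj p \<noteq> 0" for p :: "('k, 'd) proj"
    unfolding proportional_def by blast
  have eq_imp: "c = d \<and> p = r"
    if cd: "c \<noteq> 0" "d \<noteq> 0" and eq: "c *s rep_proj p = d *s rep_proj r"
    for c d and p r :: "('k, 'd) proj"
  proof -
    have "rep_proj r = (c / d) *s rep_proj p"
      using eq cd by (simp add: vec_eq_iff field_simps)
    then have "proportional (rep_proj p) (rep_proj r)"
      using cd rep_nz unfolding proportional_def by auto
    then have pr: "p = r"
      using Quotient_rel_rep[OF Quotient_proj] by blast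
    \<comment> \<open>A nonzero coordinate of the common representative can be cancelled, which
      identifies the scalars.\<close>
    obtain i where "rep_proj r $ i \<noteq> 0" using rep_nz[of r] by (auto simp: vec_eq_iff)
    then show "c = d \<and> p = r" using eq pr by (auto simp: vec_eq_iff)
  qed
  have "inj_on ?f ((UNIV - {0}) \<times> UNIV)"
    by (rule inj_onI) (use eq_imp in force)
  moreover have "?f ` ((UNIV - {0}) \<times> UNIV) \<subseteq> UNIV - {0}"
  proof -
    have "c *s v \<noteq> 0" if "c \<noteq> 0" "v \<noteq> 0" for c and v :: "'k ^ 'd"
      using that by (auto simp: vec_eq_iff)
    then show ?thesis using rep_nz by auto
  qed
  ultimately have "card ((UNIV - {0 :: 'k}) \<times> (UNIV :: ('k, 'd) proj set))
      \<le> card (UNIV - {0 :: 'k ^ 'd})"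
    by (intro card_inj_on_le) auto
  then have "(?q - 1) * CARD(('k, 'd) proj) \<le> ?q ^ CARD('d) - 1"
    by (simp add: card_cartesian_product card_Diff_subset)
  also have "?q ^ m - 1 = (?q - 1) * (\<Sum>i<m. ?q ^ i)" for m
  proof -
    \<comment> \<open>Over the integers, subtraction is not truncated and the ring identity for
      geometric sums applies.\<close>
    have "int (?q ^ m - 1) = int ((?q - 1) * (\<Sum>i<m. ?q ^ i))"
      using power_diff_1_eq[of "int ?q" m] by (simp add: Suc_leI)
    then show ?thesis by linarith
  qed
  finally show ?thesis using two_le_card_field[where 'k = 'k] by simp
qed

theorem corollary4:
  fixes n :: nat
    and scale :: "'k::{field,finite} \<Rightarrow> 'v::ab_group_add \<Rightarrow> 'v"
    and \<phi> :: "'v \<Rightarrow> (('k, 'd::finite) proj \<Rightarrow> 'k)"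
    and G :: "'v set"
    and V :: "('k, 'd) proj set"
  assumes "CARD('d) = n + 1"
    and "vector_space scale"
    and "Vector_Spaces.linear scale map_scale \<phi>"
    and "V = {x. \<forall>f\<in>G. \<phi> f x = 0}"
    and "V \<noteq> {}"
  shows "\<exists>m\<le>n. \<exists>h :: nat \<Rightarrow> 'v. V = {x. \<forall>i\<in>{1..m}. \<phi> (h i) x = 0}"
proof -
  interpret \<phi>: Vector_Spaces.linear scale map_scale \<phi> by (rule assms(3))
  let ?P = "UNIV :: ('k, 'd) proj set"
  define W where "W = fun_space.span (\<phi> ` G)"
  have W: "fun_space.subspace W" unfolding W_def by (rule fun_space.subspace_span)
  \<comment> \<open>Averaging over \<open>W\<close> needs it finite; this holds even for infinite
    \<open>G\<close>, as there are only finitely many functions on the points.\<close>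
  have "finite (UNIV :: (('k, 'd) proj \<Rightarrow> 'k) set)"
    by (simp add: finite_UNIV_fun finite_proj)
  then have fin: "finite W" by (rule rev_finite_subset) simp
  \<comment> \<open>A point of \<open>V\<close> is missing from the complement; this offsets the
    summand \<open>1\<close> of the point count.\<close>
  have "card (- V) < card ?P"
    using assms(5) finite_proj by (intro psubset_card_mono) auto
  also have "\<dots> \<le> (\<Sum>i<Suc n. CARD('k) ^ i)"
    using card_proj_le[where 'k = 'k and 'd = 'd] assms(1) by simp
  also have "\<dots> = 1 + (\<Sum>i=1..n. CARD('k) ^ i)"
    by (simp add: lessThan_Suc_atMost atMost_atLeast0 sum.atLeast_Suc_atMost)
  finally have "card (- V) \<le> (\<Sum>i=1..n. CARD('k) ^ i)" by simp
  moreover have "finite (- V)"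
    using finite_proj by (rule rev_finite_subset) simp
  moreover have "\<exists>g\<in>W. g x \<noteq> 0" if x: "x \<in> - V" for x
  proof -
    obtain f where "f \<in> G" "\<phi> f x \<noteq> 0" using x assms(4) by auto
    then show ?thesis unfolding W_def by (intro bexI[of _ "\<phi> f"] fun_space.span_base) auto
  qed
  ultimately have "\<exists>h. (\<forall>i. h i \<in> W) \<and> (\<forall>x\<in>- V. \<exists>i\<in>{1..n}. h i x \<noteq> 0)"
    by (intro exists_no_common_zero[OF W fin])
  then obtain h where h: "\<And>i. h i \<in> W" "\<And>x. x \<in> - V \<Longrightarrow> \<exists>i\<in>{1..n}. h i x \<noteq> 0"
    by blast
  \<comment> \<open>Members of \<open>W\<close> vanish on \<open>V\<close>, so the chosen functions
    cut out no less than \<open>V\<close>; by their choice they cut out no more.\<close>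
  have "W \<subseteq> {g. \<forall>x\<in>V. g x = 0}"
    unfolding W_def
    using assms(4) by (intro fun_space.span_minimal fun_space.subspaceI) (auto simp: map_scale_def)
  then have "V = {x. \<forall>i\<in>{1..n}. h i x = 0}" using h by blast
  \<comment> \<open>By linearity each chosen function is the image of a single vector, so
    \<open>m = n\<close> vectors suffice.\<close>
  moreover have "W = \<phi> ` \<phi>.vs1.span G" unfolding W_def by (rule \<phi>.span_image)
  then have "\<forall>i. \<exists>f. h i = \<phi> f" using h(1) by blast
  then obtain k where "\<And>i. h i = \<phi> (k i)" by metis
  ultimately show ?thesis by auto
qed

end
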